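(* Let $n\ge 1$. For each tropically regular matrix $A\in M_n(\mathbb{T})$ over the extended tropical semiring, put $A^{\triangledown}=\mathrm{Adj}(A)/|A|$. Then the products $AA^{\triangledown}$ and $A^{\triangledown}A$ are idempotent matrices, i.e. $(AA^{\triangledown})^2=AA^{\triangledown}$ and $(A^{\triangledown}A)^2=A^{\triangledown}A$.
   Context: Extended tropical semiring. Let $\mathbb{R}^\nu=\{a^\nu : a\in\mathbb{R}\}$ be a disjoint copy of $\mathbb{R}$, let $-\infty$ be a formal element, and put $\mathbb{T}=\mathbb{R}\cup\{-\infty\}\cup\mathbb{R}^\nu$ (disjoint union), $\bar{\mathbb{R}}^\nu=\mathbb{R}^\nu\cup\{-\infty\}$. Order $\prec$ on $\mathbb{T}$: $-\infty\prec x$ for all $x\ne-\infty$; for real $a<b$: $a\prec b$, $a\prec b^\nu$, $a^\nu\prec b$, $a^\nu\prec b^\nu$; and $a\prec a^\nu$ for all $a\in\mathbb{R}$. Addition $\oplus$: $-\infty\oplus x=x\oplus-\infty=x$; $x\oplus y=\max_\prec\{x,y\}$ if $x\neq y$; $a\oplus a=a^\nu\oplus a^\nu=a^\nu$ for $a\in\mathbb{R}$. Multiplication $\odot$ (written as juxtaposition): $-\infty\odot x=x\odot-\infty=-\infty$; $a\odot b=a+b$ for $a,b\in\mathbb{R}$; $a^\nu\odot b=a\odot b^\nu=a^\nu\odot b^\nu=(a+b)^\nu$. This is a commutative semiring with zero $-\infty$ and unit the real number $0$. $M_n(\mathbb{T})$ is the semiring of $n\times n$ matrices over $\mathbb{T}$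 with the usual matrix operations induced from $\oplus,\odot$. The tropical determinant of $A=(a_{ij})$ is $|A|=\bigoplus_{\sigma\in S_n} a_{1\sigma(1)}\odot\cdots\odot a_{n\sigma(n)}$. $A$ is tropically singular if $|A|\in\bar{\mathbb{R}}^\nu$, and tropically regular otherwise (i.e. if $|A|\in\mathbb{R}$). The minor $A_{ij}$ is obtained from $A$ by deleting row $i$ and column $j$ (the determinant of the empty matrix is $0$), and $\mathrm{Adj}(A)$ is the transpose of the matrix $(|A_{ij}|)$, i.e. its $(i,j)$ entry is $|A_{ji}|$. For $A$ regular, $\mathrm{Adj}(A)/|A|$ is the matrix obtained by multiplying ($\odot$) every entry of $\mathrm{Adj}(A)$ by the real number $-|A|$. *)

theory Defs
  imports "Jordan_Normal_Form.Determinant"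
begin

text \<open>The extended tropical semiring: \<open>Real a\<close> is the real number \<open>a\<close>, \<open>Ghost a\<close> is its copy
  \<open>a\<^sup>\<nu>\<close>, and \<open>MInf\<close> is the formal element \<open>-\<infinity>\<close>.\<close>

datatype trop = MInf | Real (real_part: real) | Ghost real

instantiation trop :: linorder
begin

fun less_trop :: "trop \<Rightarrow> trop \<Rightarrow> bool" where
  "MInf < y \<longleftrightarrow> y \<noteq> MInf"
| "Real a < MInf \<longleftrightarrow> False"
| "Real a < Real b \<longleftrightarrow> a < b"
| "Real a < Ghost b \<longleftrightarrow> a \<le> b"
| "Ghost a < MInf \<longleftrightarrow> False"
| "Ghost a < Real b \<longleftrightarrow> a < b"
| "Ghost a < Ghost b \<longleftrightarrow> a < b"

definition less_eq_trop :: "trop \<Rightarrow> trop \<Rightarrow> bool" where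
  "x \<le> y \<longleftrightarrow> x < y \<or> x = (y :: trop)"

instance
proof
  fix x y z :: trop
  show "(x < y) = (x \<le> y \<and> \<not> y \<le> x)"
    by (cases x; cases y) (auto simp: less_eq_trop_def)
  show "x \<le> x"
    by (simp add: less_eq_trop_def)
  show "x \<le> y \<Longrightarrow> y \<le> z \<Longrightarrow> x \<le> z"
    by (cases x; cases y; cases z) (auto simp: less_eq_trop_def)
  show "x \<le> y \<Longrightarrow> y \<le> x \<Longrightarrow> x = y"
    by (cases x; cases y) (auto simp: less_eq_trop_def)
  show "x \<le> y \<or> y \<le> x"
    by (cases x; cases y) (auto simp: less_eq_trop_def)
qed

end

text \<open>Tropical addition and multiplication are the class operations \<open>+\<close> and \<open>*\<close>. In particular the
  class constant \<open>0\<close> is \<open>-\<infinity>\<close>, and the class constant \<open>1\<close> is the real number zero.\<close>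

instantiation trop :: comm_semiring_1
begin

definition zero_trop :: trop where
  "0 = MInf"

definition one_trop :: trop where
  "1 = Real 0"

definition plus_trop :: "trop \<Rightarrow> trop \<Rightarrow> trop" where
  "x + y = (if x \<noteq> y then max x y
            else case x of MInf \<Rightarrow> MInf | Real a \<Rightarrow> Ghost a | Ghost a \<Rightarrow> Ghost a)"

fun times_trop :: "trop \<Rightarrow> trop \<Rightarrow> trop" where
  "MInf * y = MInf"
| "Real a * MInf = MInf"
| "Real a * Real b = Real (a + b)"
| "Real a * Ghost b = Ghost (a + b)"
| "Ghost a * MInf = MInf"
| "Ghost a * Real b = Ghost (a + b)"
| "Ghost a * Ghost b = Ghost (a + b)"

instance
proof
  fix x y z :: trop
  show "x + y + z = x + (y + z)"
    by (cases x; cases y; cases z) (auto simp: plus_trop_def max_def less_eq_trop_def)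
  show "x + y = y + x"
    by (cases x; cases y) (auto simp: plus_trop_def max_def less_eq_trop_def)
  show "0 + x = x"
    by (cases x) (auto simp: plus_trop_def zero_trop_def max_def less_eq_trop_def)
  show "x * y * z = x * (y * z)"
    by (cases x; cases y; cases z) auto
  show "x * y = y * x"
    by (cases x; cases y) auto
  show "1 * x = x"
    by (cases x) (auto simp: one_trop_def)
  show "0 * x = 0"
    by (simp add: zero_trop_def)
  show "x * 0 = 0"
    by (cases x) (simp_all add: zero_trop_def)
  show "(x + y) * z = x * z + y * z"
    by (cases x; cases y; cases z) (auto simp: plus_trop_def max_def less_eq_trop_def)
  show "(0::trop) \<noteq> 1"
    by (simp add: zero_trop_def one_trop_def)
qed

end

text \<open>The definitions below are meant for square matrices. The library determinant and adjugate carry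
  signs and need a ring, so unsigned versions are defined here.\<close>

definition trop_det :: "trop mat \<Rightarrow> trop" where
  "trop_det A = (\<Sum>p | p permutes {0..<dim_row A}. \<Prod>i = 0..<dim_row A. A $$ (i, p i))"

definition trop_singular :: "trop mat \<Rightarrow> bool" where
  "trop_singular A \<longleftrightarrow> trop_det A \<in> range Ghost \<union> {MInf}"

abbreviation trop_regular :: "trop mat \<Rightarrow> bool" where
  "trop_regular A \<equiv> \<not> trop_singular A"

definition trop_adj :: "trop mat \<Rightarrow> trop mat" where
  "trop_adj A = mat (dim_row A) (dim_col A) (\<lambda>(i, j). trop_det (mat_delete A j i))"

text \<open>\<open>Adj(A)/|A|\<close>. The value of \<open>real_part\<close> is only specified on real arguments, so this is
  meaningful only for regular \<open>A\<close>; the minus sign is ordinary negation in the reals.\<close>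

definition trop_tri :: "trop mat \<Rightarrow> trop mat"  (\<open>_\<^sup>\<nabla>\<close> [1000] 999) where
  "A\<^sup>\<nabla> = Real (- real_part (trop_det A)) \<cdot>\<^sub>m trop_adj A"

end

theory Submission
  imports Defs
begin

text \<open>Write \<open>P\<^sub>i\<^sub>j\<close> for the \<open>(i, j)\<close> entry of \<open>A * trop_adj A\<close>. As over a ring, Laplace expansion shows that
\<open>P\<^sub>i\<^sub>j\<close> is the determinant of \<open>A\<close> with row \<open>j\<close> replaced by row \<open>i\<close>. Hence \<open>P\<^sub>i\<^sub>i = |A|\<close>, while for
\<open>i \<noteq> j\<close> two rows agree, so the permutations pair up with equal products and \<open>P\<^sub>i\<^sub>j\<close> has the form
\<open>x + x\<close>: it is a ghost or \<open>-\<infinity>\<close>, and absorbs everything below it. There is no cancellation, so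
unlike over a ring \<open>P\<^sub>i\<^sub>j\<close> need not vanish.

In the square of \<open>P\<close>, the \<open>(i, j)\<close> entry is the sum of the \<open>P\<^sub>i\<^sub>k P\<^sub>k\<^sub>j\<close>. The summands for \<open>k = i\<close> and
\<open>k = j\<close>, which are the same one if \<open>i = j\<close>, equal \<open>|A| P\<^sub>i\<^sub>j\<close>. The others are harmless once
\<open>P\<^sub>i\<^sub>k P\<^sub>k\<^sub>j \<le> |A| P\<^sub>i\<^sub>j\<close> for \<open>j \<noteq> i, k\<close>, and \<open>P\<^sub>i\<^sub>k P\<^sub>k\<^sub>i < |A|\<^sup>2\<close> for \<open>i \<noteq> k\<close>.
Both inequalities come from one exchange argument (lemma \<open>row_exchange\<close>). A term of \<open>P\<^sub>i\<^sub>k\<close> times a term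
of \<open>P\<^sub>k\<^sub>j\<close> is a product over a bipartite multigraph between rows and columns, the union of two
permutations; by swapping the two permutations along suitable cycles, the same multigraph is written
as the union of a term of \<open>|A|\<close> and a term of \<open>P\<^sub>i\<^sub>j\<close>. If \<open>i = j\<close>, the result is a product of terms of
\<open>|A|\<close> belonging to two \<^emph>\<open>different\<close> permutations. Since \<open>|A|\<close> is a real number, its
maximum is attained by one permutation only, which makes the second inequality strict.

After division by \<open>|A|\<close> this says that \<open>A * A\<^sup>\<nabla>\<close> is the unit on the diagonal and transitively closed
off it, which forces idempotence. The other product is obtained by transposition.\<close>

section \<open>Order and addition of tropical numbers\<close>

lemma trop_zero_le: "0 \<le> (x :: trop)"
  by (cases x) (auto simp: zero_trop_def less_eq_trop_def)

lemma trop_le_add: "x \<le> x + (y :: trop)"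
  by (cases x; cases y) (auto simp: plus_trop_def max_def less_eq_trop_def)

lemma trop_mult_mono: "x \<le> y \<Longrightarrow> u \<le> v \<Longrightarrow> x * u \<le> y * (v :: trop)"
  by (cases x; cases y; cases u; cases v) (auto simp: less_eq_trop_def)

lemma trop_mult_strict_mono_Real:
  "x < Real c \<Longrightarrow> y \<le> Real d \<Longrightarrow> x * y < Real c * Real d"
  by (cases x; cases y) (auto simp: less_eq_trop_def)

text \<open>The condition \<open>g + g = g\<close> says that \<open>g\<close> is a ghost or \<open>-\<infinity>\<close>. It is essential: if \<open>x = y = g\<close> is real,
the sum is the ghost of \<open>g\<close>, which lies strictly above \<open>g\<close>.\<close>

lemma trop_add_least: "x \<le> g \<Longrightarrow> y \<le> g \<Longrightarrow> g + g = g \<Longrightarrow> x + y \<le> (g :: trop)"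
  by (cases x; cases y; cases g) (auto simp: plus_trop_def max_def less_eq_trop_def)

text \<open>For strict bounds the situation is reversed: the ghost of a real below \<open>c\<close> is still below
\<open>Real c\<close>, so a real bound survives the creation of ghosts.\<close>

lemma trop_add_less_Real: "x < Real c \<Longrightarrow> y < Real c \<Longrightarrow> x + y < Real c"
  by (cases x; cases y) (auto simp: plus_trop_def max_def less_eq_trop_def)

lemma trop_Real_absorb: "x < Real c \<Longrightarrow> Real c + x = Real c"
  by (cases x) (auto simp: plus_trop_def max_def less_eq_trop_def)

lemma trop_add_eq_RealD:
  "x + y = Real c \<Longrightarrow> x = Real c \<and> y < Real c \<or> x < Real c \<and> y = Real c"
  by (cases x; cases y) (auto simp: plus_trop_def max_def less_eq_trop_def split: if_splits)

lemma trop_double_idem: "(x + x) + (x + x) = x + (x :: trop)"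
  by (cases x) (auto simp: plus_trop_def)

lemma trop_member_le_sum:
  fixes f :: "'a \<Rightarrow> trop"
  assumes "finite S" "x \<in> S"
  shows "f x \<le> sum f S"
  using trop_le_add[of "f x" "sum f (S - {x})"] assms by (simp add: sum.remove)

lemma trop_sum_least:
  fixes f :: "'a \<Rightarrow> trop"
  assumes "\<And>x. x \<in> S \<Longrightarrow> f x \<le> g" and "g + g = g"
  shows "sum f S \<le> g"
  using assms(1)
  by (induction S rule: infinite_finite_induct) (auto simp: trop_zero_le intro: trop_add_least assms(2))

lemma trop_sum_less_Real:
  fixes f :: "'a \<Rightarrow> trop"
  assumes "\<And>x. x \<in> S \<Longrightarrow> f x < Real c"
  shows "sum f S < Real c"
  using assms
  by (induction S rule: infinite_finite_induct) (auto simp: zero_trop_def intro: trop_add_less_Real)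

text \<open>A second summand reaching the maximum would turn the sum into a ghost. This is how regularity of a
matrix enters: the maximal term of its determinant is unique.\<close>

lemma trop_sum_eq_RealD:
  fixes f :: "'a \<Rightarrow> trop"
  assumes "finite S" "sum f S = Real c"
  obtains x where "x \<in> S" "f x = Real c" "\<And>y. y \<in> S \<Longrightarrow> y \<noteq> x \<Longrightarrow> f y < Real c"
proof -
  have "\<exists>x\<in>S. f x = Real c \<and> (\<forall>y\<in>S. y \<noteq> x \<longrightarrow> f y < Real c)"
    using assms
  proof (induction S rule: finite_induct)
    case empty
    then show ?case by (simp add: zero_trop_def)
  next
    case (insert a S)
    from insert.prems insert.hyps have "f a + sum f S = Real c" by simp
    from trop_add_eq_RealD[OF this] show ?case
    proof
      assume a: "f a = Real c \<and> sum f S < Real c"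
      have "f y < Real c" if "y \<in> S" for y
        using trop_member_le_sum[OF insert.hyps(1) that, of f] a by auto
      with a show ?case by blast
    next
      assume a: "f a < Real c \<and> sum f S = Real c"
      with insert.IH obtain x where "x \<in> S" "f x = Real c" "\<forall>y\<in>S. y \<noteq> x \<longrightarrow> f y < Real c"
        by blast
      with a show ?case by blast
    qed
  qed
  then show thesis using that by blast
qed

section \<open>Exchanging parts of two permutations\<close>

text \<open>A transposition merges or splits cycles: if \<open>j\<close> and \<open>k\<close> lie on the same cycle of \<open>\<rho>\<close>, they lie on
different cycles of \<open>transpose j k \<circ> \<rho>\<close>. The set \<open>C\<close> is the cycle of \<open>k\<close> for whichever of the two
permutations separates \<open>k\<close> from \<open>j\<close>.\<close>

lemma permutation_swapping_separates:
  assumes \<rho>: "\<rho> permutes S" and "j \<in> S" "k \<in> S" "j \<noteq> k"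
  obtains C where "C \<subseteq> S" "k \<in> C" "j \<notin> C"
    "\<rho> ` C \<subseteq> C \<or> (transpose j k \<circ> \<rho>) ` C \<subseteq> C"
proof (cases "\<exists>m. (\<rho> ^^ m) k = j")
  case False
  have "(\<rho> ^^ m) k \<in> S" for m
    using permutes_in_image[OF \<rho>] assms by (induction m) auto
  moreover have "\<rho> ` range (\<lambda>m. (\<rho> ^^ m) k) \<subseteq> range (\<lambda>m. (\<rho> ^^ m) k)"
    by (auto intro: range_eqI[of _ _ "Suc m" for m])
  moreover have "k \<in> range (\<lambda>m. (\<rho> ^^ m) k)"
    by (rule range_eqI[of _ _ 0]) simp
  ultimately show thesis
    using False by (intro that[of "range (\<lambda>m. (\<rho> ^^ m) k)"]) auto
next
  case True
  define m where "m = (LEAST m. (\<rho> ^^ m) k = j)"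
  have m: "(\<rho> ^^ m) k = j"
    unfolding m_def using True by (rule LeastI_ex)
  have least: "(\<rho> ^^ a) k \<noteq> j" if "a < m" for a
    using not_less_Least that unfolding m_def by blast
  \<comment> \<open>The orbit of \<open>k\<close> cannot close up before it has met \<open>j\<close>, since it would then never meet \<open>j\<close>.\<close>
  have noret: "(\<rho> ^^ a) k \<noteq> k" if "0 < a" "a < m" for a
  proof
    assume "(\<rho> ^^ a) k = k"
    then have "(\<rho> ^^ (m - a)) k = (\<rho> ^^ (m - a)) ((\<rho> ^^ a) k)" by simp
    also have "\<dots> = (\<rho> ^^ (m - a + a)) k" by (simp only: funpow_add comp_apply)
    also have "\<dots> = j" using that m by simp
    finally show False using least[of "m - a"] that by simp
  qed
  define C where "C = (\<lambda>a. (\<rho> ^^ a) k) ` {..<m}"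
  have m0: "0 < m" using m assms(4) by (cases m) auto
  have S: "(\<rho> ^^ a) k \<in> S" for a
    using permutes_in_image[OF \<rho>] assms by (induction a) auto
  have kC: "k \<in> C" unfolding C_def using m0 by (intro image_eqI[of _ _ 0]) auto
  have "(transpose j k \<circ> \<rho>) ((\<rho> ^^ a) k) \<in> C" if "a < m" for a
  proof (cases "Suc a = m")
    case True
    \<comment> \<open>The step that would reach \<open>j\<close> is redirected to \<open>k\<close>, which closes the cycle.\<close>
    then have "\<rho> ((\<rho> ^^ a) k) = j" using m by auto
    then show ?thesis using kC by simp
  next
    case False
    then have a: "Suc a < m" using that by simp
    have "(\<rho> ^^ Suc a) k \<noteq> j" "(\<rho> ^^ Suc a) k \<noteq> k"
      using least[OF a] noret[of "Suc a"] a by blast+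
    then have "(transpose j k \<circ> \<rho>) ((\<rho> ^^ a) k) = (\<rho> ^^ Suc a) k"
      by (simp add: transpose_def)
    then show ?thesis unfolding C_def using a by blast
  qed
  then have "(transpose j k \<circ> \<rho>) ` C \<subseteq> C" unfolding C_def by blast
  with kC show thesis
    using least S by (intro that[of C]) (auto simp: C_def)
qed

lemma permutes_glue:
  assumes \<sigma>: "\<sigma> permutes S" and \<tau>: "\<tau> permutes S" and "C \<subseteq> S" and eq: "\<sigma> ` C = \<tau> ` C"
  shows "(\<lambda>s. if s \<in> C then \<tau> s else \<sigma> s) permutes S"
proof (rule bij_imp_permutes)
  let ?g = "\<lambda>s. if s \<in> C then \<tau> s else \<sigma> s"
  have "bij_betw \<tau> C (\<sigma> ` C)"
    unfolding eq using permutes_inj_on[OF \<tau>] by (simp add: bij_betw_def)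
  then have 1: "bij_betw ?g C (\<sigma> ` C)"
    by (rule bij_betw_cong[THEN iffD1, rotated]) simp
  have "bij_betw \<sigma> (S - C) (\<sigma> ` (S - C))"
    using permutes_inj_on[OF \<sigma>] by (simp add: bij_betw_def)
  then have 2: "bij_betw ?g (S - C) (\<sigma> ` (S - C))"
    by (rule bij_betw_cong[THEN iffD1, rotated]) simp
  have "\<sigma> ` C \<inter> \<sigma> ` (S - C) = {}"
    using permutes_inj[OF \<sigma>] by (auto dest: injD)
  from bij_betw_combine[OF 1 2 this] have "bij_betw ?g (C \<union> (S - C)) (\<sigma> ` (C \<union> (S - C)))"
    by (simp only: image_Un)
  moreover have "C \<union> (S - C) = S" using \<open>C \<subseteq> S\<close> by blast
  ultimately show "bij_betw ?g S S" using permutes_image[OF \<sigma>] by simp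
next
  fix s assume "s \<notin> S"
  then show "(if s \<in> C then \<tau> s else \<sigma> s) = s"
    using \<open>C \<subseteq> S\<close> permutes_not_in[OF \<sigma>] by auto
qed

text \<open>Think of \<open>w r c\<close> as the weight of an edge from row \<open>r\<close> to column \<open>c\<close>. The first permutation carries row
\<open>i\<close> at position \<open>k\<close>, the second carries row \<open>k\<close> at position \<open>j\<close>. Interchanging the two on \<open>C\<close>, which
contains \<open>k\<close> and not \<open>j\<close>, moves row \<open>k\<close> into the first permutation and row \<open>i\<close> into the second. The
second then has row \<open>i\<close> at position \<open>k\<close> and row \<open>k\<close> at position \<open>j\<close>; the transposition moves them to
their proper places \<open>j\<close> and \<open>k\<close>.\<close>

lemma exchange_on_common_image:
  fixes w :: "'a \<Rightarrow> 'a \<Rightarrow> 'b :: comm_monoid_mult"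
  assumes \<sigma>: "\<sigma> permutes S" and \<tau>: "\<tau> permutes S"
    and C: "C \<subseteq> S" "\<sigma> ` C = \<tau> ` C" "k \<in> C" "j \<in> S - C"
  obtains \<sigma>' \<tau>' where "\<sigma>' permutes S" "\<tau>' permutes S" "\<sigma>' \<noteq> \<tau>'"
    "(\<Prod>s\<in>S. w ((id(k := i)) s) (\<sigma> s)) * (\<Prod>s\<in>S. w ((id(j := k)) s) (\<tau> s)) =
     (\<Prod>s\<in>S. w s (\<sigma>' s)) * (\<Prod>s\<in>S. w ((id(j := i)) s) (\<tau>' s))"
proof -
  let ?t = "transpose j k"
  have jk: "j \<noteq> k" using C by auto
  have t: "?t permutes S" using C by (intro permutes_swap_id) auto
  define \<alpha> where "\<alpha> = (\<lambda>s. if s \<in> C then \<tau> s else \<sigma> s)"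
  define \<beta> where "\<beta> = (\<lambda>s. if s \<in> C then \<sigma> s else \<tau> s)"
  have \<alpha>: "\<alpha> permutes S" unfolding \<alpha>_def by (rule permutes_glue[OF \<sigma> \<tau> C(1,2)])
  have \<beta>: "\<beta> permutes S" unfolding \<beta>_def by (rule permutes_glue[OF \<tau> \<sigma> C(1) C(2)[symmetric]])
  \<comment> \<open>They take the values \<open>\<sigma> j\<close> and \<open>\<sigma> k\<close> at \<open>j\<close>.\<close>
  have "\<alpha> j \<noteq> (\<beta> \<circ> ?t) j"
    using C jk permutes_inj[OF \<sigma>] by (auto simp: \<alpha>_def \<beta>_def dest: injD)
  then have ne: "\<alpha> \<noteq> \<beta> \<circ> ?t" by metis
  have "(\<Prod>s\<in>S. w ((id(j := i)) s) ((\<beta> \<circ> ?t) s)) = (\<Prod>s\<in>S. w ((id(j := i)) (?t s)) (\<beta> s))"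
    by (subst prod.permute[OF t]) (simp add: comp_def)
  then have "(\<Prod>s\<in>S. w s (\<alpha> s)) * (\<Prod>s\<in>S. w ((id(j := i)) s) ((\<beta> \<circ> ?t) s)) =
      (\<Prod>s\<in>S. w s (\<alpha> s) * w ((id(j := i)) (?t s)) (\<beta> s))"
    by (simp add: prod.distrib)
  also have "\<dots> = (\<Prod>s\<in>S. w ((id(k := i)) s) (\<sigma> s) * w ((id(j := k)) s) (\<tau> s))"
    using C jk by (intro prod.cong) (auto simp: \<alpha>_def \<beta>_def transpose_def mult.commute)
  finally show thesis
    using that[OF \<alpha> permutes_compose[OF t \<beta>] ne] by (simp add: prod.distrib)
qed

text \<open>To apply the previous lemma one needs a set \<open>C\<close> on which \<open>\<sigma>\<close> and \<open>\<tau>\<close> have the same image, that is, a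
union of cycles of \<open>inv \<tau> \<circ> \<sigma>\<close>, separating \<open>k\<close> from \<open>j\<close>. If \<open>j\<close> and \<open>k\<close> share a cycle, no such set
exists; but the second product carries row \<open>k\<close> at both positions \<open>j\<close> and \<open>k\<close>, so it does not change
when \<open>\<tau>\<close> is replaced by \<open>\<tau> \<circ> transpose j k\<close>, and this splits the cycle.\<close>

lemma row_exchange:
  fixes w :: "'a \<Rightarrow> 'a \<Rightarrow> 'b :: comm_monoid_mult"
  assumes fin: "finite S" and \<sigma>: "\<sigma> permutes S" and \<tau>: "\<tau> permutes S"
    and jk: "j \<in> S" "k \<in> S" "j \<noteq> k"
  obtains \<sigma>' \<tau>' where "\<sigma>' permutes S" "\<tau>' permutes S" "\<sigma>' \<noteq> \<tau>'"
    "(\<Prod>s\<in>S. w ((id(k := i)) s) (\<sigma> s)) * (\<Prod>s\<in>S. w ((id(j := k)) s) (\<tau> s)) =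
     (\<Prod>s\<in>S. w s (\<sigma>' s)) * (\<Prod>s\<in>S. w ((id(j := i)) s) (\<tau>' s))"
proof -
  let ?t = "transpose j k"
  have t: "?t permutes S" using jk by (intro permutes_swap_id) auto
  have \<rho>: "Hilbert_Choice.inv \<tau> \<circ> \<sigma> permutes S" using permutes_compose[OF \<sigma> permutes_inv[OF \<tau>]] .
  from permutation_swapping_separates[OF \<rho> jk] obtain C where
    C: "C \<subseteq> S" "k \<in> C" "j \<notin> C" and invariant: "(Hilbert_Choice.inv \<tau> \<circ> \<sigma>) ` C \<subseteq> C \<or> (?t \<circ> (Hilbert_Choice.inv \<tau> \<circ> \<sigma>)) ` C \<subseteq> C"
    by blast
  have image: "\<sigma> ` C = \<tau>' ` C" if \<tau>': "\<tau>' permutes S" and sub: "\<And>s. s \<in> C \<Longrightarrow> \<sigma> s \<in> \<tau>' ` C" for \<tau>'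
  proof (rule card_subset_eq)
    show "finite (\<tau>' ` C)" using fin C(1) by (auto intro: finite_subset)
    show "\<sigma> ` C \<subseteq> \<tau>' ` C" using sub by auto
    show "card (\<sigma> ` C) = card (\<tau>' ` C)"
      using permutes_inj_on[OF \<sigma>] permutes_inj_on[OF \<tau>'] by (simp add: card_image)
  qed
  from invariant show thesis
  proof
    assume a: "(Hilbert_Choice.inv \<tau> \<circ> \<sigma>) ` C \<subseteq> C"
    have "\<sigma> s \<in> \<tau> ` C" if "s \<in> C" for s
      using a that permutes_inverses(1)[OF \<tau>] by (intro image_eqI[of _ _ "Hilbert_Choice.inv \<tau> (\<sigma> s)"]) auto
    from exchange_on_common_image[OF \<sigma> \<tau> C(1) image[OF \<tau> this] C(2)] that C(3) jk(1)
    show thesis by blast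
  next
    assume a: "(?t \<circ> (Hilbert_Choice.inv \<tau> \<circ> \<sigma>)) ` C \<subseteq> C"
    have \<tau>t: "\<tau> \<circ> ?t permutes S" using permutes_compose[OF t \<tau>] .
    have "\<sigma> s \<in> (\<tau> \<circ> ?t) ` C" if "s \<in> C" for s
      using a that permutes_inverses(1)[OF \<tau>]
      by (intro image_eqI[of _ _ "?t (Hilbert_Choice.inv \<tau> (\<sigma> s))"]) auto
    note img = image[OF \<tau>t this]
    have "(\<Prod>s\<in>S. w ((id(j := k)) s) (\<tau> s)) = (\<Prod>s\<in>S. w ((id(j := k)) (?t s)) ((\<tau> \<circ> ?t) s))"
      by (subst prod.permute[OF t]) (simp add: comp_def)
    also have "\<dots> = (\<Prod>s\<in>S. w ((id(j := k)) s) ((\<tau> \<circ> ?t) s))"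
      by (intro prod.cong) (auto simp: transpose_def)
    finally have eq: "(\<Prod>s\<in>S. w ((id(j := k)) s) (\<tau> s)) = \<dots>" .
    from exchange_on_common_image[OF \<sigma> \<tau>t C(1) img C(2)] C(3) jk(1)
    obtain \<sigma>' \<tau>' where "\<sigma>' permutes S" "\<tau>' permutes S" "\<sigma>' \<noteq> \<tau>'"
      "(\<Prod>s\<in>S. w ((id(k := i)) s) (\<sigma> s)) * (\<Prod>s\<in>S. w ((id(j := k)) s) ((\<tau> \<circ> ?t) s)) =
       (\<Prod>s\<in>S. w s (\<sigma>' s)) * (\<Prod>s\<in>S. w ((id(j := i)) s) (\<tau>' s))"
      by blast
    then show thesis using that unfolding eq by blast
  qed
qed

section \<open>Tropical determinants\<close>

definition pick_rows :: "(nat \<Rightarrow> nat) \<Rightarrow> 'a mat \<Rightarrow> 'a mat" where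
  "pick_rows f A = mat (dim_row A) (dim_col A) (\<lambda>(r, c). A $$ (f r, c))"

lemma trop_det_pick_rows:
  assumes "A \<in> carrier_mat n n"
  shows "trop_det (pick_rows f A) =
    (\<Sum>p | p permutes {0..<n}. \<Prod>r = 0..<n. A $$ (f r, p r))"
  unfolding trop_det_def pick_rows_def using assms
  by (auto intro!: sum.cong prod.cong dest: permutes_in_image)

lemma trop_det_transpose:
  assumes A: "A \<in> carrier_mat n n"
  shows "trop_det A\<^sup>T = trop_det A"
proof -
  have "trop_det A\<^sup>T = (\<Sum>p | p permutes {0..<n}. \<Prod>i = 0..<n. A $$ (p i, i))"
    unfolding trop_det_def using A
    by (auto intro!: sum.cong prod.cong dest: permutes_in_image)
  also have "\<dots> = (\<Sum>p | p permutes {0..<n}. \<Prod>i = 0..<n. A $$ (i, Hilbert_Choice.inv p i))"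
  proof (rule sum.cong[OF refl])
    fix p assume "p \<in> {p. p permutes {0..<n}}"
    then have p: "p permutes {0..<n}" by simp
    show "(\<Prod>i = 0..<n. A $$ (p i, i)) = (\<Prod>i = 0..<n. A $$ (i, Hilbert_Choice.inv p i))"
      using permutes_inverses(2)[OF p]
      by (subst (2) prod.permute[OF p]) (simp add: comp_def)
  qed
  also have "\<dots> = (\<Sum>p | p permutes {0..<n}. \<Prod>i = 0..<n. A $$ (i, p i))"
    by (rule sum_permutations_inverse[symmetric])
  finally show ?thesis using A by (simp add: trop_det_def)
qed

text \<open>The permutations are grouped by the column \<open>c\<close> that they assign to row \<open>j\<close>, as over a ring, but
without signs.\<close>

lemma trop_det_laplace_row:
  assumes A: "A \<in> carrier_mat n n" and j: "j < n"
  shows "trop_det A = (\<Sum>c = 0..<n. A $$ (j, c) * trop_det (mat_delete A j c))"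
proof -
  obtain l where n: "n = Suc l" using j by (cases n) auto
  note A = A[unfolded n] and j = j[unfolded n]
  let ?N = "{0..<Suc l}" and ?perms = "\<lambda>m. {p. p permutes {0..<m::nat}}"
  let ?h = "\<lambda>p. \<Prod>i\<in>?N. A $$ (i, p i)"
  have "trop_det A = sum ?h (?perms (Suc l))"
    unfolding trop_det_def using A by simp
  also have "\<dots> = (\<Sum>c\<in>?N. sum ?h {p \<in> ?perms (Suc l). p j = c})"
    using j by (intro sum.group[symmetric]) (auto simp: finite_permutations permutes_in_image)
  also have "\<dots> = (\<Sum>c\<in>?N. A $$ (j, c) * trop_det (mat_delete A j c))"
  proof (rule sum.cong[OF refl])
    fix c assume "c \<in> ?N"
    then have c: "c < Suc l" by simp
    have "sum ?h {p \<in> ?perms (Suc l). p j = c} = sum ?h (permutation_insert j c ` ?perms l)"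
      using permutation_fix[OF j c] by simp
    also have "\<dots> = (\<Sum>q\<in>?perms l. ?h (permutation_insert j c q))"
      by (simp add: sum.reindex[OF permutation_insert_inj_on[OF j c]])
    also have "\<dots> = (\<Sum>q\<in>?perms l. A $$ (j, c) * (\<Prod>i = 0..<l. mat_delete A j c $$ (i, q i)))"
    proof (rule sum.cong[OF refl])
      fix q assume "q \<in> ?perms l"
      then have q: "q permutes {0..<l}" by simp
      let ?p = "permutation_insert j c q"
      have p: "?p (insert_index j i) = insert_index c (q i)" for i
        by (auto simp: permutation_insert_expand insert_index_def)
      have "?h ?p = A $$ (j, c) * (\<Prod>i\<in>?N - {j}. A $$ (i, ?p i))"
        using j by (subst prod.remove[of _ j]) auto
      also have "(\<Prod>i\<in>?N - {j}. A $$ (i, ?p i)) =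
          (\<Prod>i = 0..<l. A $$ (insert_index j i, ?p (insert_index j i)))"
        unfolding insert_index_image[OF j, symmetric]
        by (subst prod.reindex) (auto intro: insert_index_inj_on)
      also have "\<dots> = (\<Prod>i = 0..<l. mat_delete A j c $$ (i, q i))"
        unfolding p using permutes_in_image[OF q]
        by (intro prod.cong refl mat_delete_index[OF A j c]) auto
      finally show "?h ?p = A $$ (j, c) * \<dots>" .
    qed
    finally show "sum ?h {p \<in> ?perms (Suc l). p j = c} = A $$ (j, c) * trop_det (mat_delete A j c)"
      using A by (simp add: trop_det_def sum_distrib_left)
  qed
  finally show ?thesis unfolding n .
qed

text \<open>Replacing row \<open>j\<close> does not affect the minors along row \<open>j\<close>, so the sum defining the product entry is
the Laplace expansion of the modified matrix along that row.\<close>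

lemma mult_trop_adj_entry:
  assumes A: "A \<in> carrier_mat n n" and ij: "i < n" "j < n"
  shows "(A * trop_adj A) $$ (i, j) = trop_det (pick_rows (id(j := i)) A)"
proof -
  let ?B = "pick_rows (id(j := i)) A"
  have B: "?B \<in> carrier_mat n n" using A by (simp add: pick_rows_def)
  have del: "mat_delete ?B j c = mat_delete A j c" if "c < n" for c
    using A that ij
    by (intro eq_matI) (auto simp: mat_delete_def pick_rows_def)
  have "(A * trop_adj A) $$ (i, j) = (\<Sum>c = 0..<n. A $$ (i, c) * trop_det (mat_delete A j c))"
    using A ij by (simp add: scalar_prod_def trop_adj_def)
  also have "\<dots> = (\<Sum>c = 0..<n. ?B $$ (j, c) * trop_det (mat_delete ?B j c))"
    using A ij del by (intro sum.cong) (auto simp: pick_rows_def)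
  also have "\<dots> = trop_det ?B" using trop_det_laplace_row[OF B ij(2)] by simp
  finally show ?thesis .
qed

text \<open>Composition with \<open>transpose i j\<close> matches the permutations with \<open>p i < p j\<close> and those with
\<open>p j < p i\<close> and preserves the products, so the determinant is the double of a partial sum.\<close>

lemma trop_det_repeated_row_idem:
  assumes A: "A \<in> carrier_mat n n" and ij: "i < n" "j < n" "i \<noteq> j" and f: "f i = f j"
  shows "trop_det (pick_rows f A) + trop_det (pick_rows f A) = trop_det (pick_rows f A)"
proof -
  let ?t = "transpose i j" and ?h = "\<lambda>p. \<Prod>r = 0..<n. A $$ (f r, p r)"
  let ?L = "{p. p permutes {0..<n} \<and> p i < p j}" and ?G = "{p. p permutes {0..<n} \<and> p j < p i}"
  have t: "?t permutes {0..<n}" using ij by (intro permutes_swap_id) auto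
  have swap: "?h (p \<circ> ?t) = ?h p" for p
  proof -
    have "?h (p \<circ> ?t) = (\<Prod>r = 0..<n. A $$ (f (?t r), p r))"
      by (subst prod.permute[OF t]) (simp add: comp_def)
    also have "\<dots> = ?h p"
      using f by (intro prod.cong) (auto simp: transpose_def)
    finally show ?thesis .
  qed
  have "sum ?h ?L = sum ?h ?G"
  proof (rule sum.reindex_bij_witness[of _ "\<lambda>p. p \<circ> ?t" "\<lambda>p. p \<circ> ?t"])
    show "?h (p \<circ> ?t) = ?h p" for p by (rule swap)
  qed (auto simp: comp_assoc permutes_compose[OF t])
  moreover have "{p. p permutes {0..<n}} = ?L \<union> ?G"
  proof (intro equalityI subsetI)
    fix p assume "p \<in> {p. p permutes {0..<n}}"
    then have p: "p permutes {0..<n}" by simp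
    then have "p i \<noteq> p j" using ij(3) permutes_inj[OF p] by (auto dest: injD)
    then have "p i < p j \<or> p j < p i" by (rule linorder_neqE) auto
    then show "p \<in> ?L \<union> ?G" using p by blast
  qed blast
  moreover have "sum ?h (?L \<union> ?G) = sum ?h ?L + sum ?h ?G"
    by (rule sum.union_disjoint) (auto intro: finite_subset[OF _ finite_permutations[of "{0..<n}"]])
  ultimately have "trop_det (pick_rows f A) = sum ?h ?L + sum ?h ?L"
    unfolding trop_det_pick_rows[OF A] by (simp only:)
  then show ?thesis by (simp only: trop_double_idem)
qed

text \<open>Every term of the expanded left-hand side is, by the exchange, a term of the right-hand side. A sum of
such terms can still exceed the right-hand side by becoming a ghost; here the right-hand side is
itself a ghost or \<open>-\<infinity>\<close>, because row \<open>i\<close> is repeated.\<close>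

lemma trop_det_exchange_le:
  assumes A: "A \<in> carrier_mat n n" and ijk: "i < n" "j < n" "k < n" "i \<noteq> j" "j \<noteq> k"
  shows "trop_det (pick_rows (id(k := i)) A) * trop_det (pick_rows (id(j := k)) A)
    \<le> trop_det A * trop_det (pick_rows (id(j := i)) A)"
proof -
  let ?N = "{0..<n}" and ?g = "trop_det A * trop_det (pick_rows (id(j := i)) A)"
  have idem: "?g + ?g = ?g"
    using trop_det_repeated_row_idem[OF A ijk(1,2,4), of "id(j := i)"] ijk(4)
    by (simp flip: distrib_left)
  have bound: "(\<Prod>s\<in>?N. A $$ ((id(k := i)) s, \<sigma> s)) * (\<Prod>s\<in>?N. A $$ ((id(j := k)) s, \<tau> s)) \<le> ?g"
    if \<sigma>\<tau>: "\<sigma> permutes ?N" "\<tau> permutes ?N" for \<sigma> \<tau>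
  proof -
    have jN: "j \<in> ?N" and kN: "k \<in> ?N" using ijk by auto
    obtain \<sigma>' \<tau>' where *: "\<sigma>' permutes ?N" "\<tau>' permutes ?N" "\<sigma>' \<noteq> \<tau>'"
      "(\<Prod>s\<in>?N. A $$ ((id(k := i)) s, \<sigma> s)) * (\<Prod>s\<in>?N. A $$ ((id(j := k)) s, \<tau> s)) =
       (\<Prod>s\<in>?N. A $$ (s, \<sigma>' s)) * (\<Prod>s\<in>?N. A $$ ((id(j := i)) s, \<tau>' s))"
      by (rule row_exchange[OF finite_atLeastLessThan \<sigma>\<tau> jN kN \<open>j \<noteq> k\<close>,
            where w = "\<lambda>r c. A $$ (r, c)" and i = i])
    have "(\<Prod>s\<in>?N. A $$ (s, \<sigma>' s)) \<le> trop_det A"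
      using *(1) A trop_member_le_sum[of "{p. p permutes ?N}" \<sigma>' "\<lambda>p. \<Prod>s\<in>?N. A $$ (s, p s)"]
      by (simp add: trop_det_def finite_permutations)
    moreover have "(\<Prod>s\<in>?N. A $$ ((id(j := i)) s, \<tau>' s)) \<le> trop_det (pick_rows (id(j := i)) A)"
      using *(2) trop_member_le_sum[of "{p. p permutes ?N}" \<tau>'
          "\<lambda>p. \<Prod>s\<in>?N. A $$ ((id(j := i)) s, p s)"]
      unfolding trop_det_pick_rows[OF A] by (simp add: finite_permutations)
    ultimately show ?thesis unfolding *(4) by (rule trop_mult_mono)
  qed
  show ?thesis
    unfolding trop_det_pick_rows[OF A, of "id(k := i)"] trop_det_pick_rows[OF A, of "id(j := k)"]
      sum_product
    using bound by (intro trop_sum_least idem) auto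
qed

text \<open>The case \<open>j = i\<close> of the exchange produces two distinct permutations of the original matrix. At most
one of them is the unique optimal permutation \<open>\<mu>\<close>, so each term lies strictly below \<open>|A|\<^sup>2\<close>.\<close>

lemma trop_det_exchange_less:
  assumes A: "A \<in> carrier_mat n n" and d: "trop_det A = Real d" and ik: "i < n" "k < n" "i \<noteq> k"
  shows "trop_det (pick_rows (id(k := i)) A) * trop_det (pick_rows (id(i := k)) A)
    < Real d * Real d"
proof -
  let ?N = "{0..<n}" and ?w = "\<lambda>p. \<Prod>s = 0..<n. A $$ (s, p s)"
  have "sum ?w {p. p permutes ?N} = Real d" using d A by (simp add: trop_det_def)
  then obtain \<mu> where \<mu>: "?w \<mu> = Real d"
    and less: "\<And>p. p permutes ?N \<Longrightarrow> p \<noteq> \<mu> \<Longrightarrow> ?w p < Real d"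
    using trop_sum_eq_RealD[of "{p. p permutes ?N}" ?w d] by (auto simp: finite_permutations)
  have le: "?w p \<le> Real d" if "p permutes ?N" for p
    using \<mu> less[OF that] by (cases "p = \<mu>") auto
  have bound: "(\<Prod>s\<in>?N. A $$ ((id(k := i)) s, \<sigma> s)) * (\<Prod>s\<in>?N. A $$ ((id(i := k)) s, \<tau> s))
      < Real (d + d)"
    if \<sigma>\<tau>: "\<sigma> permutes ?N" "\<tau> permutes ?N" for \<sigma> \<tau>
  proof -
    have iN: "i \<in> ?N" and kN: "k \<in> ?N" using ik by auto
    obtain \<sigma>' \<tau>' where *: "\<sigma>' permutes ?N" "\<tau>' permutes ?N" "\<sigma>' \<noteq> \<tau>'"
      "(\<Prod>s\<in>?N. A $$ ((id(k := i)) s, \<sigma> s)) * (\<Prod>s\<in>?N. A $$ ((id(i := k)) s, \<tau> s)) =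
       ?w \<sigma>' * (\<Prod>s\<in>?N. A $$ ((id(i := i)) s, \<tau>' s))"
      by (rule row_exchange[OF finite_atLeastLessThan \<sigma>\<tau> iN kN \<open>i \<noteq> k\<close>,
            where w = "\<lambda>r c. A $$ (r, c)" and i = i])
    have "(\<Prod>s\<in>?N. A $$ ((id(i := i)) s, \<tau>' s)) = ?w \<tau>'"
      by (intro prod.cong) auto
    moreover have "?w \<sigma>' * ?w \<tau>' < Real d * Real d"
    proof (cases "\<sigma>' = \<mu>")
      case True
      then have "?w \<tau>' < Real d" using less *(2,3) by auto
      from trop_mult_strict_mono_Real[OF this le[OF *(1)]] show ?thesis by (simp add: mult.commute)
    next
      case False
      from trop_mult_strict_mono_Real[OF less[OF *(1) this] le[OF *(2)]] show ?thesis .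
    qed
    ultimately show ?thesis unfolding *(4) by simp
  qed
  show ?thesis
    unfolding trop_det_pick_rows[OF A] sum_product times_trop.simps
    using bound by (intro trop_sum_less_Real) auto
qed

section \<open>Idempotence\<close>

text \<open>Off the diagonal, \<open>E * E \<le> E\<close> by transitivity, and \<open>E \<le> E * E\<close> because of the unit diagonal. On the
diagonal the unit is a real number, which absorbs the strictly smaller products
\<open>E\<^sub>i\<^sub>k E\<^sub>k\<^sub>i\<close>; a mere \<open>\<le>\<close> there could turn it into a ghost.\<close>

lemma idempotent_mat_criterion:
  fixes E :: "trop mat"
  assumes E: "E \<in> carrier_mat n n"
    and diag: "\<And>i. i < n \<Longrightarrow> E $$ (i, i) = 1"
    and idem: "\<And>i j. i < n \<Longrightarrow> j < n \<Longrightarrow> i \<noteq> j \<Longrightarrow> E $$ (i, j) + E $$ (i, j) = E $$ (i, j)"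
    and trans: "\<And>i j k. i < n \<Longrightarrow> j < n \<Longrightarrow> k < n \<Longrightarrow> i \<noteq> j \<Longrightarrow> j \<noteq> k \<Longrightarrow>
      E $$ (i, k) * E $$ (k, j) \<le> E $$ (i, j)"
    and cycle: "\<And>i k. i < n \<Longrightarrow> k < n \<Longrightarrow> i \<noteq> k \<Longrightarrow> E $$ (i, k) * E $$ (k, i) < 1"
  shows "E * E = E"
proof (rule eq_matI)
  fix i j assume "i < dim_row E" "j < dim_col E"
  then have ij: "i < n" "j < n" using E by auto
  let ?f = "\<lambda>k. E $$ (i, k) * E $$ (k, j)"
  have EE: "(E * E) $$ (i, j) = sum ?f {0..<n}"
    using E ij by (simp add: scalar_prod_def)
  show "(E * E) $$ (i, j) = E $$ (i, j)"
  proof (cases "i = j")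
    case True
    have "sum ?f {0..<n} = ?f i + sum ?f ({0..<n} - {i})"
      using ij by (intro sum.remove) auto
    also have "\<dots> = Real 0 + sum ?f ({0..<n} - {i})"
      using True diag ij by (simp add: one_trop_def)
    also have "\<dots> = Real 0"
      using cycle ij True
      by (intro trop_Real_absorb trop_sum_less_Real) (auto simp: one_trop_def)
    finally show ?thesis using EE True diag ij by (simp add: one_trop_def)
  next
    case False
    have "sum ?f {0..<n} \<le> E $$ (i, j)"
    proof (rule trop_sum_least[OF _ idem[OF ij False]])
      fix k assume "k \<in> {0..<n}"
      then show "?f k \<le> E $$ (i, j)"
        using trans[OF ij, of k] diag[OF ij(2)] False by (cases "k = j") auto
    qed
    moreover have "E $$ (i, j) \<le> sum ?f {0..<n}"
      using trop_member_le_sum[of "{0..<n}" i ?f] diag ij by simp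
    ultimately show ?thesis using EE by simp
  qed
qed (use E in auto)

lemma mult_trop_tri_idempotent:
  assumes A: "A \<in> carrier_mat n n" and reg: "trop_regular A"
  shows "(A * A\<^sup>\<nabla>) * (A * A\<^sup>\<nabla>) = A * A\<^sup>\<nabla>"
proof -
  obtain d where d: "trop_det A = Real d"
    using reg by (cases "trop_det A") (auto simp: trop_singular_def)
  let ?P = "\<lambda>i j. trop_det (pick_rows (id(j := i)) A)"
  have adj: "trop_adj A \<in> carrier_mat n n" using A by (simp add: trop_adj_def)
  have "A * A\<^sup>\<nabla> = Real (- d) \<cdot>\<^sub>m (A * trop_adj A)"
    unfolding trop_tri_def d using mult_smult_distrib[OF A adj] by simp
  then have entry: "(A * A\<^sup>\<nabla>) $$ (i, j) = Real (- d) * ?P i j" if "i < n" "j < n" for i j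
    using A adj that by (simp add: mult_trop_adj_entry[OF A that] del: index_mult_mat(1))
  have car: "A * A\<^sup>\<nabla> \<in> carrier_mat n n"
    using A adj by (simp add: trop_tri_def)
  have "pick_rows (id(i := i)) A = A" for i
    using A by (intro eq_matI) (auto simp: pick_rows_def)
  then have diag: "?P i i = Real d" for i using d by simp
  have mult: "(Real (- d) * x) * (Real (- d) * y) = (Real (- d) * Real (- d)) * (x * y)" for x y
    by (simp only: mult_ac)
  show ?thesis
  proof (rule idempotent_mat_criterion[OF car])
    fix i assume i: "i < n"
    show "(A * A\<^sup>\<nabla>) $$ (i, i) = 1"
      unfolding entry[OF i i] diag by (simp add: one_trop_def)
  next
    fix i j assume ij: "i < n" "j < n" "i \<noteq> j"
    then have "?P i j + ?P i j = ?P i j"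
      by (intro trop_det_repeated_row_idem[OF A, of i j]) auto
    then show "(A * A\<^sup>\<nabla>) $$ (i, j) + (A * A\<^sup>\<nabla>) $$ (i, j) = (A * A\<^sup>\<nabla>) $$ (i, j)"
      unfolding entry[OF ij(1,2)] by (simp flip: distrib_left)
  next
    fix i j k assume ijk: "i < n" "j < n" "k < n" "i \<noteq> j" "j \<noteq> k"
    have "(Real (- d) * Real (- d)) * (?P i k * ?P k j) \<le>
        (Real (- d) * Real (- d)) * (Real d * ?P i j)"
      using trop_det_exchange_le[OF A ijk] unfolding d by (rule trop_mult_mono[OF order_refl])
    also have "\<dots> = Real (- d) * ?P i j"
      by (simp flip: mult.assoc)
    finally show "(A * A\<^sup>\<nabla>) $$ (i, k) * (A * A\<^sup>\<nabla>) $$ (k, j) \<le> (A * A\<^sup>\<nabla>) $$ (i, j)"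
      using ijk by (simp only: entry mult)
  next
    fix i k assume ik: "i < n" "k < n" "i \<noteq> k"
    have "(?P i k * ?P k i) * Real (- d + - d) < (Real (d + d)) * Real (- d + - d)"
      using trop_det_exchange_less[OF A d ik]
      by (intro trop_mult_strict_mono_Real) simp_all
    then show "(A * A\<^sup>\<nabla>) $$ (i, k) * (A * A\<^sup>\<nabla>) $$ (k, i) < 1"
      using ik by (simp add: entry mult one_trop_def mult.commute del: index_mult_mat(1))
  qed
qed

lemma trop_tri_transpose:
  assumes A: "A \<in> carrier_mat n n"
  shows "(A\<^sup>T)\<^sup>\<nabla> = (A\<^sup>\<nabla>)\<^sup>T"
proof -
  have "trop_det (mat_delete A\<^sup>T i j) = trop_det (mat_delete A j i)" if "i < n" "j < n" for i j
  proof -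
    have "mat_delete A\<^sup>T i j = (mat_delete A j i)\<^sup>T"
      using A that by (intro eq_matI) (auto simp: mat_delete_def)
    then show ?thesis using trop_det_transpose[OF mat_delete_carrier[OF A]] by simp
  qed
  then have "trop_adj A\<^sup>T = (trop_adj A)\<^sup>T"
    using A by (intro eq_matI) (auto simp: trop_adj_def)
  then show ?thesis
    using A by (intro eq_matI) (auto simp: trop_tri_def trop_det_transpose[OF A])
qed

theorem theorem3p8:
  fixes n :: nat and A :: "trop mat"
  assumes "n \<ge> 1"
    and "A \<in> carrier_mat n n"
    and "trop_regular A"
  shows "(A * A\<^sup>\<nabla>) ^\<^sub>m 2 = A * A\<^sup>\<nabla> \<and> (A\<^sup>\<nabla> * A) ^\<^sub>m 2 = A\<^sup>\<nabla> * A"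
proof -
  note A = assms(2)
  have tri: "A\<^sup>\<nabla> \<in> carrier_mat n n" using A by (simp add: trop_tri_def trop_adj_def)
  have square: "B ^\<^sub>m 2 = B * B" if "B \<in> carrier_mat n n" for B :: "trop mat"
    using that by (simp add: numeral_2_eq_2)
  have "trop_regular A\<^sup>T" using assms(3) by (simp add: trop_singular_def trop_det_transpose[OF A])
  then have "(A\<^sup>T * (A\<^sup>T)\<^sup>\<nabla>) * (A\<^sup>T * (A\<^sup>T)\<^sup>\<nabla>) = A\<^sup>T * (A\<^sup>T)\<^sup>\<nabla>"
    using A by (intro mult_trop_tri_idempotent[of _ n]) auto
  moreover have T: "A\<^sup>T * (A\<^sup>T)\<^sup>\<nabla> = (A\<^sup>\<nabla> * A)\<^sup>T"
    unfolding trop_tri_transpose[OF A] using transpose_mult[OF tri A] by simp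
  ultimately have "((A\<^sup>\<nabla> * A) * (A\<^sup>\<nabla> * A))\<^sup>T = (A\<^sup>\<nabla> * A)\<^sup>T"
    using transpose_mult[OF mult_carrier_mat[OF tri A] mult_carrier_mat[OF tri A]] by simp
  then have "(A\<^sup>\<nabla> * A) * (A\<^sup>\<nabla> * A) = A\<^sup>\<nabla> * A"
    by (simp only: transpose_mat_eq)
  with mult_trop_tri_idempotent[OF A assms(3)] show ?thesis
    using square[OF mult_carrier_mat[OF A tri]] square[OF mult_carrier_mat[OF tri A]] by simp
qed

end
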